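(* Fix $\ell\ge1$, $m\ge0$, and $\ell$-tuples of non-negative integers $\vec\alpha,\vec\beta$; let $\hat e_1=(1,0,\dots,0)$. Then for all $n\ge0$, $$\sum_{i=0}^n\binom{n}{i}M^\ell_{i,m}(\vec\alpha,\vec\beta)=M^\ell_{n,m}(\vec\alpha+\hat e_1,\vec\beta+\hat e_1),$$ i.e. the binomial transform of $\{M^\ell_{n,m}(\vec\alpha,\vec\beta)\}_{n\ge0}$ is $\{M^\ell_{n,m}(\vec\alpha+\hat e_1,\vec\beta+\hat e_1)\}_{n\ge0}$.
   Context: An order-$\ell$ Motzkin path of length $n$ and height $m$ is an integer lattice path from $(0,0)$ to $(n,m)$ using steps $U=(1,1)$ and $D_i=(1,-i)$ for $0\le i\le \ell$, never going below $y=0$. For $\ell$-tuples of non-negative integers $\vec\alpha=(\alpha_0,\dots,\alpha_{\ell-1}),\vec\beta=(\beta_0,\dots,\beta_{\ell-1})$, an $(\vec\alpha,\vec\beta)$-colored Motzkin path is such a path in which, for each $0\le i\le \ell-1$, each $D_i$ step whose right endpoint is at height $0$ is labeled by one of $\alpha_i$ colors and each $D_i$ step whose right endpoint is at height $>0$ is labeled by one of $\beta_i$ colors; $U$ and $D_\ell$ steps are unlabeled. $M^\ell_{n,m}(\vec\alpha,\vec\beta)$ is the number of such colored paths of length $n$ and height $m$. *)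

theory Defs
  imports Complex_Main "HOL-Library.Product_Plus"
begin

datatype step = U | D nat

fun step_vec :: "step \<Rightarrow> int \<times> int" where
  "step_vec U = (1, 1)"
| "step_vec (D i) = (1, - int i)"

text \<open>The lattice point reached from the origin after the first \<open>k\<close> steps of \<open>p\<close>.\<close>

definition vertex :: "step list \<Rightarrow> nat \<Rightarrow> int \<times> int" where
  "vertex p k = (\<Sum>s\<leftarrow>take k p. step_vec s)"

text \<open>Order-\<open>l\<close> Motzkin paths of length \<open>n\<close> and height \<open>m\<close>.  A step always moves right by
  one, so nonnegativity at the vertices is nonnegativity along the whole path.\<close>

definition motzkin_paths :: "nat \<Rightarrow> nat \<Rightarrow> nat \<Rightarrow> step list set" where
  "motzkin_paths l n m =
     {p. set p \<subseteq> {U} \<union> D ` {0..l} \<and>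
         (\<forall>k\<le>length p. 0 \<le> snd (vertex p k)) \<and>
         vertex p (length p) = (int n, int m)}"

text \<open>The labels allowed on the step of \<open>p\<close> at position \<open>j\<close> (counting from 0), whose right
  endpoint is \<open>vertex p (Suc j)\<close>.  An unlabeled step carries \<open>None\<close>; the \<open>c\<close> colors are
  \<open>Some 0, \<dots>, Some (c - 1)\<close>, so a step with 0 available colors cannot occur.  The tuples
  \<open>\<alpha>\<close> and \<open>\<beta>\<close> are lists, meant to have length \<open>l\<close>.\<close>

definition step_labels ::
  "nat \<Rightarrow> nat list \<Rightarrow> nat list \<Rightarrow> step list \<Rightarrow> nat \<Rightarrow> nat option set" where
  "step_labels l \<alpha> \<beta> p j =
     (case p ! j of
        U \<Rightarrow> {None}
      | D i \<Rightarrow>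
          if i = l then {None}
          else if snd (vertex p (Suc j)) = 0 then Some ` {0..<\<alpha> ! i}
          else Some ` {0..<\<beta> ! i})"

definition colored_motzkin_paths ::
  "nat \<Rightarrow> nat list \<Rightarrow> nat list \<Rightarrow> nat \<Rightarrow> nat \<Rightarrow> (step list \<times> nat option list) set" where
  "colored_motzkin_paths l \<alpha> \<beta> n m =
     {(p, c). p \<in> motzkin_paths l n m \<and> length c = length p \<and>
              (\<forall>j<length p. c ! j \<in> step_labels l \<alpha> \<beta> p j)}"

definition motzkin_number :: "nat \<Rightarrow> nat list \<Rightarrow> nat list \<Rightarrow> nat \<Rightarrow> nat \<Rightarrow> nat" where
  "motzkin_number l \<alpha> \<beta> n m = card (colored_motzkin_paths l \<alpha> \<beta> n m)"

definition tuple_add :: "nat list \<Rightarrow> nat list \<Rightarrow> nat list" where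
  "tuple_add \<alpha> \<beta> = map2 (+) \<alpha> \<beta>"

definition e1 :: "nat \<Rightarrow> nat list" where
  "e1 l = 1 # replicate (l - 1) 0"

lemma fst_vertex: "fst (vertex p k) = int (length (take k p))"
proof -
  have "fst (\<Sum>s\<leftarrow>q. step_vec s) = int (length q)" for q
  proof (induction q)
    case (Cons s q)
    then show ?case by (cases s) simp_all
  qed simp
  then show ?thesis by (simp add: vertex_def)
qed

lemma length_motzkin_path: "p \<in> motzkin_paths l n m \<Longrightarrow> length p = n"
  using fst_vertex[of p "length p"] by (auto simp: motzkin_paths_def)

text \<open>The set counted by \<open>motzkin_number\<close> is finite, so \<open>card\<close> is a genuine count.\<close>

lemma finite_colored_motzkin_paths: "finite (colored_motzkin_paths l \<alpha> \<beta> n m)"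
proof -
  let ?C = "\<lambda>p. {c. length c = length p \<and> (\<forall>j<length p. c ! j \<in> step_labels l \<alpha> \<beta> p j)}"
  have "motzkin_paths l n m \<subseteq> {p. set p \<subseteq> {U} \<union> D ` {0..l} \<and> length p = n}"
    using length_motzkin_path by (auto simp: motzkin_paths_def)
  then have P: "finite (motzkin_paths l n m)"
    by (rule finite_subset) (intro finite_lists_length_eq, simp)
  have C: "finite (?C p)" for p
  proof -
    have "?C p \<subseteq> {c. set c \<subseteq> (\<Union>j<length p. step_labels l \<alpha> \<beta> p j) \<and> length c = length p}"
      by (fastforce simp: in_set_conv_nth)
    moreover
    have "finite (step_labels l \<alpha> \<beta> p j)" for j
      by (auto simp: step_labels_def split: step.split)
    then have "finite {c. set c \<subseteq> (\<Union>j<length p. step_labels l \<alpha> \<beta> p j) \<and> length c = length p}"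
      by (intro finite_lists_length_eq) simp
    ultimately show ?thesis
      by (rule finite_subset)
  qed
  have "colored_motzkin_paths l \<alpha> \<beta> n m = (SIGMA p : motzkin_paths l n m. ?C p)"
    by (auto simp: colored_motzkin_paths_def)
  with P C show ?thesis by auto
qed

end

theory Submission
  imports Defs
begin

text \<open>Deleting the last step of a path shows that the array \<open>M\<^sub>n\<^sub>,\<^sub>m\<close> satisfies
  \<open>M\<^sub>n\<^sub>+\<^sub>1 = T M\<^sub>n\<close> for a linear operator \<open>T\<close> on sequences in \<open>m\<close>.  Adding \<open>e1\<close> to both
  color tuples replaces \<open>T\<close> by \<open>T + I\<close>, because a \<open>D 0\<close> step keeps the height and, as
  \<open>l \<ge> 1\<close>, is a colored step.  Since \<open>M\<^sub>0\<close> does not depend on the colors, the claim is the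
  binomial expansion of \<open>(T + I)\<^sup>n M\<^sub>0\<close>.\<close>

text \<open>The labels allowed on a step depend on the path only through the height of the step's
  right endpoint. Making this dependence explicit lets the last label be chosen independently of the
  rest of a path with prescribed final height.\<close>

definition end_labels ::
  "nat \<Rightarrow> nat list \<Rightarrow> nat list \<Rightarrow> step \<Rightarrow> int \<Rightarrow> nat option set" where
  "end_labels l \<alpha> \<beta> s h =
     (case s of
        U \<Rightarrow> {None}
      | D i \<Rightarrow>
          if i = l then {None}
          else if h = 0 then Some ` {0..<\<alpha> ! i}
          else Some ` {0..<\<beta> ! i})"

lemma step_labels_eq_end_labels:
  "step_labels l \<alpha> \<beta> p j = end_labels l \<alpha> \<beta> (p ! j) (snd (vertex p (Suc j)))"
  by (simp add: step_labels_def end_labels_def)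

text \<open>These are the coefficients of the operator \<open>T\<close> at the down steps.\<close>

definition down_weight :: "nat \<Rightarrow> nat list \<Rightarrow> nat list \<Rightarrow> nat \<Rightarrow> nat \<Rightarrow> nat" where
  "down_weight l \<alpha> \<beta> m i = (if i = l then 1 else if m = 0 then \<alpha> ! i else \<beta> ! i)"

lemma card_end_labels_D: "card (end_labels l \<alpha> \<beta> (D i) (int m)) = down_weight l \<alpha> \<beta> m i"
  by (simp add: end_labels_def down_weight_def card_image)

lemma finite_end_labels: "finite (end_labels l \<alpha> \<beta> s h)"
  by (auto simp: end_labels_def split: step.split)

lemma vertex_append_left: "k \<le> length p \<Longrightarrow> vertex (p @ q) k = vertex p k"
  by (simp add: vertex_def)

lemma vertex_snoc: "vertex (p @ [s]) (Suc (length p)) = vertex p (length p) + step_vec s"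
  by (simp add: vertex_def)

text \<open>The only new vertex is the endpoint, whose height \<open>m\<close> is a natural number,
  so it cannot violate nonnegativity. Conversely, the prefix ends at a vertex of nonnegative height,
  and that height serves as \<open>h\<close>.\<close>

lemma snoc_in_motzkin_paths_iff:
  "p @ [s] \<in> motzkin_paths l (Suc n) m \<longleftrightarrow>
     s \<in> {U} \<union> D ` {0..l} \<and>
     (\<exists>h. p \<in> motzkin_paths l n h \<and> int m = int h + snd (step_vec s))"
  (is "?L \<longleftrightarrow> ?S \<and> ?R")
proof -
  have 1: "(\<forall>k\<le>length (p @ [s]). 0 \<le> snd (vertex (p @ [s]) k)) \<longleftrightarrow>
      (\<forall>k\<le>length p. 0 \<le> snd (vertex p k)) \<and> 0 \<le> snd (vertex p (length p) + step_vec s)"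
    by (auto simp: le_Suc_eq vertex_append_left vertex_snoc)
  have 2: "fst (step_vec s) = 1"
    by (cases s) auto
  show ?thesis
  proof
    assume L: ?L
    then have nonneg: "0 \<le> snd (vertex p (length p))"
      using 1 by (simp add: motzkin_paths_def)
    have "p \<in> motzkin_paths l n (nat (snd (vertex p (length p))))"
      using L 1 2 nonneg by (auto simp: motzkin_paths_def vertex_snoc prod_eq_iff)
    moreover have "int m = snd (vertex p (length p)) + snd (step_vec s)"
      using L by (simp add: motzkin_paths_def vertex_snoc prod_eq_iff)
    ultimately have ?R
      using nonneg by (intro exI[of _ "nat (snd (vertex p (length p)))"]) simp
    moreover have ?S
      using L by (simp add: motzkin_paths_def)
    ultimately show "?S \<and> ?R"
      by blast
  next
    assume "?S \<and> ?R"
    then show ?L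
      unfolding motzkin_paths_def mem_Collect_eq 1
      using 2 by (auto simp: vertex_snoc prod_eq_iff)
  qed
qed

text \<open>Appending a step moves no earlier vertex, so the earlier labels stay valid and only the
  new label has to be checked, against height \<open>m\<close>.\<close>

lemma snoc_in_colored_motzkin_paths_iff:
  "(p @ [s], c @ [x]) \<in> colored_motzkin_paths l \<alpha> \<beta> (Suc n) m \<longleftrightarrow>
     s \<in> {U} \<union> D ` {0..l} \<and> x \<in> end_labels l \<alpha> \<beta> s (int m) \<and>
     (\<exists>h. (p, c) \<in> colored_motzkin_paths l \<alpha> \<beta> n h \<and> int m = int h + snd (step_vec s))"
proof -
  have "(\<forall>j<length (p @ [s]). (c @ [x]) ! j \<in> step_labels l \<alpha> \<beta> (p @ [s]) j) \<longleftrightarrow>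
      (\<forall>j<length p. c ! j \<in> step_labels l \<alpha> \<beta> p j) \<and> x \<in> end_labels l \<alpha> \<beta> s (int m)"
    if "p @ [s] \<in> motzkin_paths l (Suc n) m" "length c = length p"
  proof -
    have "snd (vertex (p @ [s]) (Suc (length p))) = int m"
      using that by (simp add: motzkin_paths_def)
    with that show ?thesis
      by (auto simp: less_Suc_eq step_labels_eq_end_labels nth_append vertex_append_left)
  qed
  then show ?thesis
    using snoc_in_motzkin_paths_iff[of p s l n m]
    by (auto simp: colored_motzkin_paths_def)
qed

definition path_extensions ::
  "nat \<Rightarrow> nat list \<Rightarrow> nat list \<Rightarrow> nat \<Rightarrow> nat \<Rightarrow> step \<Rightarrow> nat \<Rightarrow> (step list \<times> nat option list) set"
  where
  "path_extensions l \<alpha> \<beta> n m s h =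
     (\<lambda>((p, c), x). (p @ [s], c @ [x])) `
       (colored_motzkin_paths l \<alpha> \<beta> n h \<times> end_labels l \<alpha> \<beta> s (int m))"

lemma card_path_extensions:
  "card (path_extensions l \<alpha> \<beta> n m s h) =
     motzkin_number l \<alpha> \<beta> n h * card (end_labels l \<alpha> \<beta> s (int m))"
proof -
  have "inj_on (\<lambda>((p, c), x). (p @ [s], c @ [x])) A"
    for A :: "((step list \<times> nat option list) \<times> nat option) set"
    by (auto simp: inj_on_def)
  then show ?thesis
    by (simp add: path_extensions_def card_image card_cartesian_product motzkin_number_def)
qed

lemma finite_path_extensions: "finite (path_extensions l \<alpha> \<beta> n m s h)"
  by (simp add: path_extensions_def finite_colored_motzkin_paths finite_end_labels)

lemma snoc_in_path_extensions_iff: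
  "(p @ [s], c @ [x]) \<in> path_extensions l \<alpha> \<beta> n m s' h \<longleftrightarrow>
     s = s' \<and> (p, c) \<in> colored_motzkin_paths l \<alpha> \<beta> n h \<and> x \<in> end_labels l \<alpha> \<beta> s (int m)"
  by (auto simp: path_extensions_def image_iff Bex_def)

lemma colored_motzkin_paths_Suc:
  "colored_motzkin_paths l \<alpha> \<beta> (Suc n) m =
     (if m = 0 then {} else path_extensions l \<alpha> \<beta> n m U (m - 1)) \<union>
     (\<Union>i\<in>{0..l}. path_extensions l \<alpha> \<beta> n m (D i) (m + i))" (is "?L = ?R")
proof -
  have snoc: "(p @ [s], c @ [x]) \<in> ?L \<longleftrightarrow> (p @ [s], c @ [x]) \<in> ?R" for p s c x
  proof (cases s)
    case U
    \<comment> \<open>The guard excludes \<open>m = 0\<close>, where the truncated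
      \<open>m - 1\<close> would be \<open>0\<close> again: no up step ends on the axis.\<close>
    have height: "int m = int h + 1 \<longleftrightarrow> m \<noteq> 0 \<and> h = m - 1" for h
      by auto
    have pred: "(\<exists>h. (p, c) \<in> colored_motzkin_paths l \<alpha> \<beta> n h \<and> int m = int h + snd (step_vec s)) \<longleftrightarrow>
        m \<noteq> 0 \<and> (p, c) \<in> colored_motzkin_paths l \<alpha> \<beta> n (m - 1)"
      by (simp only: U step_vec.simps snd_conv height) blast
    show ?thesis
      by (simp only: snoc_in_colored_motzkin_paths_iff pred) (auto simp: U snoc_in_path_extensions_iff)
  next
    case (D i)
    have height: "int m = int h + - int i \<longleftrightarrow> h = m + i" for h
      by auto
    have pred: "(\<exists>h. (p, c) \<in> colored_motzkin_paths l \<alpha> \<beta> n h \<and> int m = int h + snd (step_vec s)) \<longleftrightarrow>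
        (p, c) \<in> colored_motzkin_paths l \<alpha> \<beta> n (m + i)"
      by (simp only: D step_vec.simps snd_conv height) blast
    show ?thesis
      by (simp only: snoc_in_colored_motzkin_paths_iff pred) (auto simp: D snoc_in_path_extensions_iff)
  qed
  \<comment> \<open>Both sides contain only pairs of nonempty lists, so comparing them on pairs of
    the form in \<open>snoc\<close> is enough.\<close>
  have L: "\<exists>p s c x. y = (p @ [s], c @ [x])" if "y \<in> ?L" for y
  proof -
    obtain p c where y: "y = (p, c)"
      by (cases y)
    with that have "length p = Suc n" "length c = length p"
      using length_motzkin_path[of p l "Suc n" m] by (simp_all add: colored_motzkin_paths_def)
    with y show ?thesis
      by (cases p rule: rev_cases; cases c rule: rev_cases) auto
  qed
  have R: "\<exists>p s c x. y = (p @ [s], c @ [x])" if "y \<in> ?R" for y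
    using that by (auto simp: path_extensions_def split: if_splits)
  show ?thesis
  proof (rule set_eqI)
    fix y
    show "y \<in> ?L \<longleftrightarrow> y \<in> ?R"
    proof (cases "\<exists>p s c x. y = (p @ [s], c @ [x])")
      case True
      then show ?thesis
        by (elim exE) (simp only: snoc)
    next
      case False
      have "y \<notin> ?L"
        using False by (rule contrapos_nn) (rule L)
      moreover have "y \<notin> ?R"
        using False by (rule contrapos_nn) (rule R)
      ultimately show ?thesis
        by (simp only:)
    qed
  qed
qed

text \<open>The sets of extensions are pairwise disjoint because their members differ in the last
  step, so their cardinalities add up. The right-hand side is \<open>T\<close> applied to row
  \<open>n\<close>.\<close>

lemma motzkin_number_Suc:
  "motzkin_number l \<alpha> \<beta> (Suc n) m =
     (if m = 0 then 0 else motzkin_number l \<alpha> \<beta> n (m - 1)) +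
     (\<Sum>i=0..l. down_weight l \<alpha> \<beta> m i * motzkin_number l \<alpha> \<beta> n (m + i))"
proof -
  let ?E = "path_extensions l \<alpha> \<beta> n m"
  let ?up = "if m = 0 then {} else ?E U (m - 1)"
  have "motzkin_number l \<alpha> \<beta> (Suc n) m = card (?up \<union> (\<Union>i\<in>{0..l}. ?E (D i) (m + i)))"
    by (simp add: motzkin_number_def colored_motzkin_paths_Suc)
  also have "\<dots> = card ?up + card (\<Union>i\<in>{0..l}. ?E (D i) (m + i))"
    by (rule card_Un_disjoint) (auto simp: finite_path_extensions, auto simp: path_extensions_def)
  also have "card (\<Union>i\<in>{0..l}. ?E (D i) (m + i)) = (\<Sum>i=0..l. card (?E (D i) (m + i)))"
    by (rule card_UN_disjoint) (auto simp: finite_path_extensions, auto simp: path_extensions_def)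
  also have "card ?up = (if m = 0 then 0 else motzkin_number l \<alpha> \<beta> n (m - 1))"
    by (simp add: card_path_extensions end_labels_def)
  finally show ?thesis
    by (simp add: card_path_extensions card_end_labels_D mult.commute)
qed

lemma motzkin_number_0: "motzkin_number l \<alpha> \<beta> 0 m = (if m = 0 then 1 else 0)"
proof -
  have paths: "p \<in> motzkin_paths l 0 m \<longleftrightarrow> p = [] \<and> m = 0" for p
  proof
    assume p: "p \<in> motzkin_paths l 0 m"
    then have "p = []"
      using length_motzkin_path by blast
    with p show "p = [] \<and> m = 0"
      by (simp add: motzkin_paths_def vertex_def prod_eq_iff)
  qed (simp add: motzkin_paths_def vertex_def zero_prod_def)
  have "colored_motzkin_paths l \<alpha> \<beta> 0 m = (if m = 0 then {([], [])} else {})"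
    unfolding colored_motzkin_paths_def paths by auto
  then show ?thesis
    by (simp add: motzkin_number_def)
qed

lemma nth_tuple_add_e1:
  assumes "i < length \<alpha>"
  shows "tuple_add \<alpha> (e1 (length \<alpha>)) ! i = \<alpha> ! i + (if i = 0 then 1 else 0)"
  using assms by (cases i) (auto simp: tuple_add_def e1_def)

text \<open>Since \<open>l \<ge> 1\<close>, the step \<open>D 0\<close> is not the unlabeled
  \<open>D l\<close>. Raising both tuples gives it one more color whether or not it ends at height
  0.\<close>

lemma down_weight_tuple_add_e1:
  assumes "l \<ge> 1" "length \<alpha> = l" "length \<beta> = l" "i \<le> l"
  shows "down_weight l (tuple_add \<alpha> (e1 l)) (tuple_add \<beta> (e1 l)) m i =
    down_weight l \<alpha> \<beta> m i + (if i = 0 then 1 else 0)"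
  using assms nth_tuple_add_e1[of i \<alpha>] nth_tuple_add_e1[of i \<beta>]
  by (auto simp: down_weight_def)

text \<open>The extra color of \<open>D 0\<close> contributes the summand \<open>N n m\<close>; this
  is the recurrence for \<open>T + I\<close>, written with the original weights.\<close>

lemma motzkin_number_tuple_add_e1_Suc:
  assumes "l \<ge> 1" "length \<alpha> = l" "length \<beta> = l"
  defines "N \<equiv> motzkin_number l (tuple_add \<alpha> (e1 l)) (tuple_add \<beta> (e1 l))"
  shows "N (Suc n) m = N n m + ((if m = 0 then 0 else N n (m - 1)) +
    (\<Sum>i=0..l. down_weight l \<alpha> \<beta> m i * N n (m + i)))"
proof -
  have "(\<Sum>i=0..l. down_weight l (tuple_add \<alpha> (e1 l)) (tuple_add \<beta> (e1 l)) m i * N n (m + i)) =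
      (\<Sum>i=0..l. down_weight l \<alpha> \<beta> m i * N n (m + i) + (if i = 0 then N n m else 0))"
    by (rule sum.cong) (auto simp: down_weight_tuple_add_e1[OF assms(1-3)])
  also have "\<dots> = (\<Sum>i=0..l. down_weight l \<alpha> \<beta> m i * N n (m + i)) + N n m"
    by (simp add: sum.distrib)
  finally show ?thesis
    by (simp add: N_def motzkin_number_Suc)
qed

text \<open>This is Pascal's rule, summed against \<open>a\<close>.\<close>

lemma binomial_transform_Suc:
  fixes a :: "nat \<Rightarrow> nat"
  shows "(\<Sum>i=0..Suc n. (Suc n choose i) * a i) =
    (\<Sum>i=0..n. (n choose i) * a i) + (\<Sum>i=0..n. (n choose i) * a (Suc i))"
proof -
  have "(\<Sum>i=0..Suc n. (Suc n choose i) * a i) =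
      a 0 + (\<Sum>i=0..n. (n choose Suc i) * a (Suc i)) + (\<Sum>i=0..n. (n choose i) * a (Suc i))"
    by (simp only: sum.atLeast0_atMost_Suc_shift)
       (simp add: sum.distrib distrib_right)
  \<comment> \<open>The added term vanishes because \<open>n choose Suc n = 0\<close>; now the term
    \<open>a 0\<close> can be split off and the remaining index shifted over the full range.\<close>
  moreover have "(\<Sum>i=0..n. (n choose i) * a i) = (\<Sum>i=0..Suc n. (n choose i) * a i)"
    by simp
  then have "(\<Sum>i=0..n. (n choose i) * a i) = a 0 + (\<Sum>i=0..n. (n choose Suc i) * a (Suc i))"
    by (simp only: sum.atLeast0_atMost_Suc_shift) simp
  ultimately show ?thesis
    by simp
qed

theorem theorem2p7:
  fixes l m n :: nat and \<alpha> \<beta> :: "nat list"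
  assumes "l \<ge> 1" and "length \<alpha> = l" and "length \<beta> = l"
  shows "(\<Sum>i=0..n. (n choose i) * motzkin_number l \<alpha> \<beta> i m)
           = motzkin_number l (tuple_add \<alpha> (e1 l)) (tuple_add \<beta> (e1 l)) n m"
\<comment> \<open>The height must vary, because the recurrence refers to the heights
  \<open>m - 1\<close> and \<open>m + i\<close>.\<close>
proof (induction n arbitrary: m)
  case 0
  show ?case
    by (simp add: motzkin_number_0)
next
  case (Suc n)
  let ?M = "motzkin_number l \<alpha> \<beta>"
  let ?w = "down_weight l \<alpha> \<beta> m"
  define S where "S m = (\<Sum>i=0..n. (n choose i) * ?M i m)" for m
  \<comment> \<open>\<open>T\<close> acts on heights and the binomial transform on lengths, so the
    two commute: transforming the rows \<open>Suc k\<close> yields \<open>T\<close> applied to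
    \<open>S\<close>.\<close>
  have "(\<Sum>k=0..n. (n choose k) * (\<Sum>i=0..l. ?w i * ?M k (m + i))) =
      (\<Sum>k=0..n. \<Sum>i=0..l. ?w i * ((n choose k) * ?M k (m + i)))"
    by (simp add: sum_distrib_left ac_simps)
  also have "\<dots> = (\<Sum>i=0..l. ?w i * S (m + i))"
    by (subst sum.swap) (simp add: S_def sum_distrib_left)
  finally have "(\<Sum>k=0..n. (n choose k) * ?M (Suc k) m) =
      (if m = 0 then 0 else S (m - 1)) + (\<Sum>i=0..l. ?w i * S (m + i))"
    by (simp add: motzkin_number_Suc S_def distrib_left sum.distrib)
  then have "(\<Sum>i=0..Suc n. (Suc n choose i) * ?M i m) =
      S m + ((if m = 0 then 0 else S (m - 1)) + (\<Sum>i=0..l. ?w i * S (m + i)))"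
    by (simp only: binomial_transform_Suc S_def)
  \<comment> \<open>The transform thus obeys the recurrence of the numbers with the enlarged tuples,
    and the induction hypothesis identifies \<open>S\<close> with their row \<open>n\<close> at
    every height.\<close>
  then show ?case
    by (simp only: motzkin_number_tuple_add_e1_Suc[OF assms] S_def Suc.IH)
qed

end
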